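(* Let $\alpha,\beta,c,d>0$ and $l\ge 0$ be real constants with $l\le\beta$ and $l<\alpha$, and assume $$\alpha<\frac{\beta(l+1)+l}{\beta+2}.$$ Then any solution $u$ on $\mathbb{R}^+$ of $$\big(|u'|^{l}u'\big)'+c|u'|^{\alpha}u'+d|u|^{\beta}u=0$$ which is not identically $0$ has a finite number of zeros on $(0,\infty)$. Moreover, for $t$ large, $u'(t)$ has the opposite sign to that of $u(t)$, and $u''(t)$ has the same sign as $u(t)$.
   Context: $\mathbb{R}^+=[0,+\infty)$. A solution on $\mathbb{R}^+$ is a function $u\in\mathcal{C}^1(\mathbb{R}^+)$ with $|u'|^lu'\in\mathcal{C}^1(\mathbb{R}^+)$ which satisfies the equation at every point. (Such a solution is twice differentiable at every point where $u'\neq 0$.) *)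

theory Defs
  imports "HOL-Analysis.Analysis"
begin

text \<open>The half-line is the set \<open>{0..}\<close>. Derivatives on it are taken relative to this set, hence are
  one-sided at \<open>0\<close> and two-sided at every \<open>t > 0\<close>; values of functions at negative arguments play
  no role.\<close>

definition deriv_rplus :: "(real \<Rightarrow> real) \<Rightarrow> real \<Rightarrow> real" where
  "deriv_rplus f t = vector_derivative f (at t within {0..})"

text \<open>The library predicate \<open>C1_differentiable_on\<close> demands two-sided derivatives and so does not fit
  the endpoint \<open>0\<close>.\<close>

definition C1_rplus :: "(real \<Rightarrow> real) \<Rightarrow> bool" where
  "C1_rplus f \<longleftrightarrow> f differentiable_on {0..} \<and> continuous_on {0..} (deriv_rplus f)"

text \<open>In \<open>\<bar>x\<bar> powr a * x\<close> the convention \<open>0 powr a = 0\<close> (also for \<open>a = 0\<close>) is harmless, because of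
  the factor \<open>x\<close>.\<close>

definition is_solution_rplus ::
  "real \<Rightarrow> real \<Rightarrow> real \<Rightarrow> real \<Rightarrow> real \<Rightarrow> (real \<Rightarrow> real) \<Rightarrow> bool" where
  "is_solution_rplus l \<alpha> \<beta> c d u \<longleftrightarrow>
     C1_rplus u \<and>
     C1_rplus (\<lambda>t. \<bar>deriv_rplus u t\<bar> powr l * deriv_rplus u t) \<and>
     (\<forall>t\<ge>0. deriv_rplus (\<lambda>s. \<bar>deriv_rplus u s\<bar> powr l * deriv_rplus u s) t
             + c * (\<bar>deriv_rplus u t\<bar> powr \<alpha> * deriv_rplus u t)
             + d * (\<bar>u t\<bar> powr \<beta> * u t) = 0)"

end

theory Submission imports Defs begin

text \<open>Write \<open>v = u'\<close> and let \<open>E\<close> be the energy, which decreases at rate \<open>c \<bar>v\<bar>\<^sup>\<alpha>\<^sup>+\<^sup>2\<close> and, as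
  \<open>l < \<alpha>\<close>, never vanishes; hence zeros of \<open>u\<close> do not accumulate at a finite time. If there were
  arbitrarily late zeros, \<open>E\<close> would tend to \<open>0\<close>, because near a zero \<open>\<bar>v\<bar>\<close> is bounded below
  in terms of \<open>E\<close> on a time interval of fixed length. So some turning point \<open>v = 0\<close> would have \<open>\<bar>u\<bar>\<close>
  small; take \<open>u > 0\<close> there. With \<open>p = (\<beta> + 1) / (\<alpha> + 1)\<close>, the upper bound on \<open>\<alpha>\<close> is exactly what
  makes the region \<open>0 \<le> - v \<le> M u\<^sup>p\<close> forward invariant for small \<open>u\<close>, and \<open>p \<ge> 1\<close> then gives
  \<open>u' \<ge> - K u\<close>, so \<open>u\<close> never vanishes again.

  Once \<open>u > 0\<close> for good, \<open>v\<close> must become negative and then stays so. The sign of \<open>u''\<close> is that of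
  \<open>c \<bar>v\<bar>\<^sup>\<alpha>\<^sup>+\<^sup>1 - d u\<^sup>\<beta>\<^sup>+\<^sup>1\<close>, which cannot stay negative, since \<open>v\<close> would decrease and \<open>u\<close> reach \<open>0\<close>,
  and which increases through each of its zeros.\<close>

section \<open>Calculus on the line: first zeros, one-way crossings, signed powers\<close>

lemma first_zero:
  fixes f :: "real \<Rightarrow> real"
  assumes cont: "continuous_on {a..b} f" and "a \<le> b" "f a > 0" "f b \<le> 0"
  obtains s where "a < s" "s \<le> b" "f s = 0" "\<And>t. a \<le> t \<Longrightarrow> t < s \<Longrightarrow> f t > 0"
proof -
  let ?Z = "{t \<in> {a..b}. f t = 0}"
  obtain x where "a \<le> x" "x \<le> b" "f x = 0"
    using IVT2'[of f b 0 a] assms by auto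
  then have "?Z \<noteq> {}" by auto
  moreover have "compact ?Z"
    using continuous_closed_preimage_constant[OF cont, of 0] 
    by (auto simp: compact_eq_bounded_closed intro: bounded_subset[OF bounded_closed_interval])
  ultimately obtain s where s: "s \<in> ?Z" "\<And>t. t \<in> ?Z \<Longrightarrow> s \<le> t"
    by (meson compact_attains_inf)
  show thesis
  proof
    show "a < s" using s(1) \<open>f a > 0\<close> by (cases "a = s") auto
    show "s \<le> b" "f s = 0" using s(1) by auto
    fix t assume t: "a \<le> t" "t < s"
    show "f t > 0"
    proof (rule ccontr)
      assume "\<not> f t > 0"
      moreover have "continuous_on {a..t} f"
        using cont by (rule continuous_on_subset) (use t s(1) in auto)
      ultimately obtain x where "a \<le> x" "x \<le> t" "f x = 0"
        using IVT2'[of f t 0 a] \<open>f a > 0\<close> t by auto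
      then show False using s(2)[of x] s(1) t by auto
    qed
  qed
qed

text \<open>At a first return to zero after positive values the slope cannot be positive. The start
  value \<open>g a = 0\<close> is allowed because several applications begin on the boundary of the
  region, for instance at a point with \<open>v = 0\<close>.\<close>

lemma stays_positive:
  fixes g :: "real \<Rightarrow> real"
  assumes cont: "continuous_on {a..b} g" and "a < b" "g a \<ge> 0"
    and cross: "\<And>t. a \<le> t \<Longrightarrow> t \<le> b \<Longrightarrow> g t = 0 \<Longrightarrow> \<exists>D>0. (g has_real_derivative D) (at t)"
  shows "g b > 0"
proof (rule ccontr)
  assume neg: "\<not> g b > 0"
  obtain a' where a': "a \<le> a'" "a' < b" "g a' > 0"
  proof (cases "g a = 0")
    case True
    then obtain D where "D > 0" "(g has_real_derivative D) (at a)"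
      using cross[of a] \<open>a < b\<close> by auto
    then obtain e where e: "e > 0" "\<And>h. h > 0 \<Longrightarrow> h < e \<Longrightarrow> g a < g (a + h)"
      using DERIV_pos_inc_right by metis
    define h where "h = min e (b - a) / 2"
    have "h > 0" "h < e" "h < b - a"
      using e(1) \<open>a < b\<close> by (auto simp: h_def min_def)
    then show thesis using that[of "a + h"] e(2)[of h] True by auto
  next
    case False
    then show thesis using that[of a] assms by auto
  qed
  have "continuous_on {a'..b} g"
    using cont by (rule continuous_on_subset) (use a' in auto)
  then obtain s where s: "a' < s" "s \<le> b" "g s = 0" "\<And>t. a' \<le> t \<Longrightarrow> t < s \<Longrightarrow> g t > 0"
    using first_zero[of a' b g] a' neg by (metis less_eq_real_def not_le_imp_less)
  obtain D where "D > 0" "(g has_real_derivative D) (at s)"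
    using cross[of s] s a' by auto
  then obtain e where e: "e > 0" "\<And>h. h > 0 \<Longrightarrow> h < e \<Longrightarrow> g (s - h) < g s"
    using DERIV_pos_inc_left by metis
  define h where "h = min e (s - a') / 2"
  have "h > 0" "h < e" "h < s - a'"
    using e(1) s by (auto simp: h_def min_def)
  then show False using e(2)[of h] s(4)[of "s - h"] s(3) by auto
qed

lemma has_real_derivative_abs_powr:
  fixes p x :: real
  assumes "p > 1"
  shows "((\<lambda>x. \<bar>x\<bar> powr p) has_real_derivative p * \<bar>x\<bar> powr (p - 1) * sgn x) (at x)"
proof -
  consider "x > 0" | "x < 0" | "x = 0" by linarith
  then show ?thesis
  proof cases
    case 1
    have "((\<lambda>x. x powr p) has_real_derivative p * x powr (p - 1)) (at x)"
      using 1 by (auto intro!: derivative_eq_intros)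
    then have "((\<lambda>x. \<bar>x\<bar> powr p) has_real_derivative p * x powr (p - 1)) (at x)"
      by (rule DERIV_cong_ev[THEN iffD1, rotated 3])
        (use 1 in \<open>auto intro!: eventually_mono[OF order_tendstoD(1)[OF tendsto_ident_at]] 
           eventually_mono[OF eventually_nhds_in_open[of "{0<..}"]]\<close>)
    then show ?thesis using 1 by simp
  next
    case 2
    have "((\<lambda>x. (- x) powr p) has_real_derivative - p * (- x) powr (p - 1)) (at x)"
      using 2 by (auto intro!: derivative_eq_intros)
    then have "((\<lambda>x. \<bar>x\<bar> powr p) has_real_derivative - p * (- x) powr (p - 1)) (at x)"
      by (rule DERIV_cong_ev[THEN iffD1, rotated 3])
        (use 2 in \<open>auto intro!: eventually_mono[OF eventually_nhds_in_open[of "{..<0}"]]\<close>)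
    then show ?thesis using 2 by simp
  next
    case 3
    \<comment> \<open>At the origin the difference quotient is
      \<open>sgn h * \<bar>h\<bar> powr (p - 1)\<close>, which tends to 0 exactly because
      \<open>p > 1\<close>.\<close>
    have "((\<lambda>h::real. \<bar>h\<bar> powr (p - 1)) \<longlongrightarrow> 0) (at 0)"
      using assms by (auto intro!: tendsto_eq_intros)
    then have "((\<lambda>h::real. sgn h * \<bar>h\<bar> powr (p - 1)) \<longlongrightarrow> 0) (at 0)"
      by (rule Lim_null_comparison[rotated]) (auto simp: abs_mult sgn_if)
    then have "((\<lambda>h::real. \<bar>h\<bar> powr p / h) \<longlongrightarrow> 0) (at 0)"
      by (rule Lim_transform_eventually)
        (auto simp: eventually_at_filter powr_diff sgn_if abs_if divide_simps intro!: always_eventually)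
    then show ?thesis using 3 by (simp add: DERIV_def)
  qed
qed

text \<open>The equation controls the derivative of \<open>w\<close>, not of \<open>v\<close>; these
  identities carry size and sign back and forth between the two.\<close>

lemma signed_root_signed_powr:
  fixes v l :: real
  assumes "l \<ge> 0" and "w = \<bar>v\<bar> powr l * v"
  shows "\<bar>w\<bar> = \<bar>v\<bar> powr (l + 1)" "sgn w = sgn v" "\<bar>w\<bar> powr (1 / (l + 1)) = \<bar>v\<bar>"
proof -
  show 1: "\<bar>w\<bar> = \<bar>v\<bar> powr (l + 1)"
    using assms by (cases "v = 0") (auto simp: abs_mult powr_add)
  show "sgn w = sgn v"
    using assms by (cases "v = 0") (auto simp: sgn_mult)
  show "\<bar>w\<bar> powr (1 / (l + 1)) = \<bar>v\<bar>"
    unfolding 1 using assms by (cases "v = 0") (auto simp: powr_powr)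
qed

text \<open>The origin is excluded: for \<open>r = 1 / (l + 1)\<close> with \<open>l > 0\<close> the
  slope there is infinite, so \<open>v\<close> may fail to be differentiable where it
  vanishes.\<close>

lemma has_real_derivative_signed_root:
  fixes r x :: real
  assumes "x \<noteq> 0"
  shows "((\<lambda>x. sgn x * \<bar>x\<bar> powr r) has_real_derivative r * \<bar>x\<bar> powr (r - 1)) (at x)"
proof (cases "x > 0")
  case True
  have "((\<lambda>x. x powr r) has_real_derivative r * x powr (r - 1)) (at x)"
    using True by (auto intro!: derivative_eq_intros)
  then have "((\<lambda>x. sgn x * \<bar>x\<bar> powr r) has_real_derivative r * x powr (r - 1)) (at x)"
    by (rule DERIV_cong_ev[THEN iffD1, rotated 3])
      (use True in \<open>auto intro!: eventually_mono[OF eventually_nhds_in_open[of "{0<..}"]]\<close>)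
  then show ?thesis using True by simp
next
  case False
  then have x: "x < 0" using assms by simp
  have "((\<lambda>x. - ((- x) powr r)) has_real_derivative r * (- x) powr (r - 1)) (at x)"
    using x by (auto intro!: derivative_eq_intros)
  then have "((\<lambda>x. sgn x * \<bar>x\<bar> powr r) has_real_derivative r * (- x) powr (r - 1)) (at x)"
    by (rule DERIV_cong_ev[THEN iffD1, rotated 3])
      (use x in \<open>auto intro!: eventually_mono[OF eventually_nhds_in_open[of "{..<0}"]]\<close>)
  then show ?thesis using x by simp
qed

section \<open>The equation as a system for position and velocity, and its energy\<close>

text \<open>The velocity \<open>v\<close> is a parameter of its own, so that the symmetry of the
  equation becomes a second interpretation, at \<open>- u\<close> and \<open>- v\<close>.\<close>

locale damped_ode =
  fixes l \<alpha> \<beta> c d :: real and u v :: "real \<Rightarrow> real"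
  assumes l_nonneg: "0 \<le> l" and l_less: "l < \<alpha>" and beta_pos: "0 < \<beta>"
    and c_pos: "0 < c" and d_pos: "0 < d"
    and u_deriv_within: "\<And>t. t \<ge> 0 \<Longrightarrow> (u has_real_derivative v t) (at t within {0..})"
    and w_deriv_within: "\<And>t. t \<ge> 0 \<Longrightarrow> ((\<lambda>s. \<bar>v s\<bar> powr l * v s) has_real_derivative
          - (c * (\<bar>v t\<bar> powr \<alpha> * v t) + d * (\<bar>u t\<bar> powr \<beta> * u t))) (at t within {0..})"
    and v_cont: "continuous_on {0..} v"
begin

lemma alpha_pos: "0 < \<alpha>"
  using l_nonneg l_less by simp

text \<open>Every term of the equation is odd. Results for \<open>u > 0\<close> thereby transfer to
  \<open>u < 0\<close>.\<close>

lemma negated: "damped_ode l \<alpha> \<beta> c d (\<lambda>t. - u t) (\<lambda>t. - v t)"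
proof
  show "((\<lambda>t. - u t) has_real_derivative - v t) (at t within {0..})" if "t \<ge> 0" for t
    using u_deriv_within[OF that] by (rule DERIV_minus)
  show "((\<lambda>s. \<bar>- v s\<bar> powr l * - v s) has_real_derivative
      - (c * (\<bar>- v t\<bar> powr \<alpha> * - v t) + d * (\<bar>- u t\<bar> powr \<beta> * - u t))) (at t within {0..})"
    if "t \<ge> 0" for t
    using DERIV_minus[OF w_deriv_within[OF that]] by simp
qed (use l_nonneg l_less beta_pos c_pos d_pos v_cont in \<open>auto intro: continuous_intros\<close>)

definition w :: "real \<Rightarrow> real" where
  "w t = \<bar>v t\<bar> powr l * v t"

definition rhs :: "real \<Rightarrow> real" where
  "rhs t = - (c * (\<bar>v t\<bar> powr \<alpha> * v t) + d * (\<bar>u t\<bar> powr \<beta> * u t))"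

definition E :: "real \<Rightarrow> real" where
  "E t = (l + 1) / (l + 2) * \<bar>v t\<bar> powr (l + 2) + d / (\<beta> + 2) * \<bar>u t\<bar> powr (\<beta> + 2)"

lemma at_within_rplus: "t > 0 \<Longrightarrow> at t within {0..} = at (t::real)"
  by (rule at_within_interior) simp

lemma u_deriv: "t > 0 \<Longrightarrow> (u has_real_derivative v t) (at t)"
  using u_deriv_within[of t] by (simp add: at_within_rplus)

lemma w_deriv: "t > 0 \<Longrightarrow> (w has_real_derivative rhs t) (at t)"
  using w_deriv_within[of t] by (simp add: at_within_rplus w_def[abs_def] rhs_def)

lemma u_cont: "continuous_on {0..} u"
  by (rule DERIV_continuous_on) (use u_deriv_within in auto)

lemma w_cont: "continuous_on {0..} w"
  unfolding w_def[abs_def] by (rule DERIV_continuous_on) (use w_deriv_within in auto)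

lemma E_cont: "continuous_on {0..} E"
  unfolding E_def[abs_def]
  by (intro continuous_intros continuous_on_powr' u_cont v_cont) (use l_nonneg beta_pos in auto)

lemma u_cont_sub: "0 \<le> a \<Longrightarrow> continuous_on {a..b} u"
  by (rule continuous_on_subset[OF u_cont]) auto

lemma v_cont_sub: "0 \<le> a \<Longrightarrow> continuous_on {a..b} v"
  by (rule continuous_on_subset[OF v_cont]) auto

lemma w_cont_sub: "0 \<le> a \<Longrightarrow> continuous_on {a..b} w"
  by (rule continuous_on_subset[OF w_cont]) auto

lemma E_cont_sub: "0 \<le> a \<Longrightarrow> continuous_on {a..b} E"
  by (rule continuous_on_subset[OF E_cont]) auto

lemmas w_facts = signed_root_signed_powr[OF l_nonneg w_def]

lemma E_nonneg: "E t \<ge> 0"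
  unfolding E_def using l_nonneg beta_pos d_pos by simp

lemma v_le_E: "\<bar>v t\<bar> powr (l + 2) \<le> (l + 2) / (l + 1) * E t"
proof -
  have "(l + 1) / (l + 2) * \<bar>v t\<bar> powr (l + 2) \<le> E t"
    unfolding E_def using beta_pos d_pos by simp
  then show ?thesis using l_nonneg by (simp add: field_simps)
qed

lemma u_le_E: "\<bar>u t\<bar> powr (\<beta> + 2) \<le> (\<beta> + 2) / d * E t"
proof -
  have "d / (\<beta> + 2) * \<bar>u t\<bar> powr (\<beta> + 2) \<le> E t"
    unfolding E_def using l_nonneg by simp
  then show ?thesis using beta_pos d_pos by (simp add: field_simps)
qed

text \<open>Differentiating \<open>v\<close> is avoided, since it may not be differentiable at its
  zeros: the kinetic term is a multiple of \<open>\<bar>w\<bar> powr p\<close> with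
  \<open>p = (l + 2) / (l + 1) > 1\<close>, and the chain rule is applied to \<open>w\<close>. The
  restoring force cancels against the potential term, leaving the dissipation.\<close>

lemma E_deriv:
  assumes "t > 0"
  shows "(E has_real_derivative - c * \<bar>v t\<bar> powr (\<alpha> + 2)) (at t)"
proof -
  define p where "p = (l + 2) / (l + 1)"
  have p: "p > 1" "p - 1 = 1 / (l + 1)" "(l + 1) * p = l + 2"
    using l_nonneg by (auto simp: p_def field_simps)
  have *: "\<bar>w s\<bar> powr p = \<bar>v s\<bar> powr (l + 2)" for s
    using p by (simp add: w_facts(1) powr_powr)
  have "((\<lambda>s. \<bar>w s\<bar> powr p) has_real_derivative p * \<bar>w t\<bar> powr (p - 1) * sgn (w t) * rhs t) (at t)"
    using DERIV_chain2[OF has_real_derivative_abs_powr[OF p(1)] w_deriv[OF assms]] .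
  moreover have "\<bar>w t\<bar> powr (p - 1) * sgn (w t) = v t"
    by (simp only: p(2) w_facts(2,3) abs_mult_sgn)
  ultimately have 1: "((\<lambda>s. \<bar>v s\<bar> powr (l + 2)) has_real_derivative p * (v t * rhs t)) (at t)"
    by (simp add: * mult.assoc[of p])
  have "((\<lambda>s. \<bar>u s\<bar> powr (\<beta> + 2)) has_real_derivative
      (\<beta> + 2) * \<bar>u t\<bar> powr (\<beta> + 2 - 1) * sgn (u t) * v t) (at t)"
    by (rule DERIV_chain2[OF has_real_derivative_abs_powr u_deriv[OF assms]]) (use beta_pos in simp)
  moreover have "\<bar>u t\<bar> powr (\<beta> + 2 - 1) * sgn (u t) = \<bar>u t\<bar> powr \<beta> * u t"
  proof -
    have "\<bar>u t\<bar> powr (\<beta> + 2 - 1) = \<bar>u t\<bar> powr \<beta> * \<bar>u t\<bar>"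
      using powr_add[of "\<bar>u t\<bar>" \<beta> 1] by (simp add: add.commute)
    then show ?thesis by (simp only: mult.assoc abs_mult_sgn)
  qed
  ultimately have 2: "((\<lambda>s. \<bar>u s\<bar> powr (\<beta> + 2)) has_real_derivative
      (\<beta> + 2) * (\<bar>u t\<bar> powr \<beta> * u t * v t)) (at t)"
    by (simp add: mult.assoc[of "\<beta> + 2"])
  have "(E has_real_derivative (l + 1) / (l + 2) * (p * (v t * rhs t))
      + d / (\<beta> + 2) * ((\<beta> + 2) * (\<bar>u t\<bar> powr \<beta> * u t * v t))) (at t)"
    unfolding E_def[abs_def] by (rule DERIV_add[OF DERIV_cmult[OF 1] DERIV_cmult[OF 2]])
  moreover have "(l + 1) / (l + 2) * (p * (v t * rhs t)) = v t * rhs t"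
    using l_nonneg by (simp add: p_def)
  moreover have "d / (\<beta> + 2) * ((\<beta> + 2) * (\<bar>u t\<bar> powr \<beta> * u t * v t)) = d * (\<bar>u t\<bar> powr \<beta> * u t * v t)"
    using beta_pos by simp
  moreover have "\<bar>v t\<bar> powr (\<alpha> + 2) = \<bar>v t\<bar> powr \<alpha> * v t * v t"
    using alpha_pos by (cases "v t = 0") (auto simp: powr_add power2_eq_square)
  moreover have "v t * rhs t + d * (\<bar>u t\<bar> powr \<beta> * u t * v t) = - c * (\<bar>v t\<bar> powr \<alpha> * v t * v t)"
    by (simp add: rhs_def algebra_simps)
  ultimately show ?thesis
    by (simp only:)
qed

lemma E_antimono:
  assumes "0 \<le> s" "s \<le> t"
  shows "E t \<le> E s"
proof (rule DERIV_nonpos_imp_decreasing_open[OF assms(2)])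
  show "\<exists>y. (E has_real_derivative y) (at x) \<and> y \<le> 0" if "s < x" "x < t" for x
    using E_deriv[of x] that assms c_pos by (intro exI[of _ "- c * \<bar>v x\<bar> powr (\<alpha> + 2)"]) auto
qed (use assms E_cont_sub in auto)

lemma v_bound:
  assumes "0 \<le> s" "s \<le> t"
  shows "\<bar>v t\<bar> \<le> ((l + 2) / (l + 1) * E s) powr (1 / (l + 2))"
proof -
  have "\<bar>v t\<bar> powr (l + 2) \<le> (l + 2) / (l + 1) * E t"
    by (rule v_le_E)
  also have "\<dots> \<le> (l + 2) / (l + 1) * E s"
    using E_antimono[OF assms] l_nonneg by (intro mult_left_mono) auto
  finally have "(\<bar>v t\<bar> powr (l + 2)) powr (1 / (l + 2)) \<le> ((l + 2) / (l + 1) * E s) powr (1 / (l + 2))"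
    using l_nonneg by (intro powr_mono2) auto
  then show ?thesis
    using l_nonneg by (simp add: powr_powr)
qed

lemma u_bound:
  assumes "0 \<le> s" "s \<le> t"
  shows "\<bar>u t\<bar> \<le> ((\<beta> + 2) / d * E s) powr (1 / (\<beta> + 2))"
proof -
  have "\<bar>u t\<bar> powr (\<beta> + 2) \<le> (\<beta> + 2) / d * E t"
    by (rule u_le_E)
  also have "\<dots> \<le> (\<beta> + 2) / d * E s"
    using E_antimono[OF assms] beta_pos d_pos by (intro mult_left_mono) auto
  finally have "(\<bar>u t\<bar> powr (\<beta> + 2)) powr (1 / (\<beta> + 2)) \<le> ((\<beta> + 2) / d * E s) powr (1 / (\<beta> + 2))"
    using beta_pos by (intro powr_mono2) auto
  then show ?thesis
    using beta_pos by (simp add: powr_powr)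
qed

text \<open>Since \<open>l < \<alpha>\<close>, the dissipation is at most a constant times the energy, and Gronwall's argument
  runs backwards in time.\<close>

lemma E_zero_backward:
  assumes "0 \<le> s" "s \<le> t" "E t = 0"
  shows "E s = 0"
proof -
  define B where "B = ((l + 2) / (l + 1) * E s) powr (1 / (l + 2))"
  define K where "K = c * (B powr (\<alpha> - l) * ((l + 2) / (l + 1)))"
  have diss: "c * \<bar>v x\<bar> powr (\<alpha> + 2) \<le> K * E x" if "s < x" "x < t" for x
  proof -
    have "\<bar>v x\<bar> \<le> B"
      unfolding B_def using v_bound[of s x] that assms by simp
    then have "\<bar>v x\<bar> powr (\<alpha> - l) \<le> B powr (\<alpha> - l)"
      using l_less by (intro powr_mono2) auto
    then have "\<bar>v x\<bar> powr (\<alpha> - l) * \<bar>v x\<bar> powr (l + 2)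
        \<le> B powr (\<alpha> - l) * ((l + 2) / (l + 1) * E x)"
      by (intro mult_mono v_le_E) auto
    then have "\<bar>v x\<bar> powr (\<alpha> + 2) \<le> B powr (\<alpha> - l) * ((l + 2) / (l + 1)) * E x"
      by (simp add: mult.assoc flip: powr_add)
    then show ?thesis
      unfolding K_def mult.assoc[of c] using c_pos by (intro mult_left_mono) auto
  qed
  \<comment> \<open>By \<open>diss\<close>, the weight \<open>exp (K * x)\<close> outgrows the decay
    of the energy.\<close>
  have "E s * exp (K * s) \<le> E t * exp (K * t)"
  proof (rule DERIV_nonneg_imp_increasing_open[OF assms(2)])
    fix x assume x: "s < x" "x < t"
    have "((\<lambda>x. E x * exp (K * x)) has_real_derivative
        (K * E x - c * \<bar>v x\<bar> powr (\<alpha> + 2)) * exp (K * x)) (at x)"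
      using x assms by (auto intro!: derivative_eq_intros E_deriv simp: algebra_simps)
    then show "\<exists>y. ((\<lambda>x. E x * exp (K * x)) has_real_derivative y) (at x) \<and> 0 \<le> y"
      using diss[OF x] by auto
  qed (use assms in \<open>auto intro!: continuous_intros E_cont_sub\<close>)
  then show ?thesis
    using assms(3) E_nonneg[of s] by (simp add: mult_le_0_iff)
qed

lemma E_pos:
  assumes "s \<ge> 0" "u s \<noteq> 0" "t \<ge> 0"
  shows "E t > 0"
proof (rule ccontr)
  assume "\<not> E t > 0"
  then have "E t = 0" using E_nonneg[of t] by simp
  then have "E s = 0"
    using E_zero_backward[of s t] E_antimono[of t s] E_nonneg[of s] assms by (cases "s \<le> t") auto
  then show False
    using u_le_E[of s] assms(2) by simp
qed

section \<open>Zeros do not accumulate at a finite time\<close>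

text \<open>An accumulation point of zeros would be a double zero, where \<open>u\<close>,
  \<open>v\<close> and hence \<open>E\<close> vanish.\<close>

lemma finite_zeros_bounded:
  assumes "\<And>t. t \<ge> 0 \<Longrightarrow> E t > 0"
  shows "finite {t \<in> {0..T}. u t = 0}"
proof (rule ccontr)
  let ?Z = "{t \<in> {0..T}. u t = 0}"
  assume "infinite ?Z"
  then obtain x where x: "x \<in> {0..T}" "x islimpt ?Z"
    using Heine_Borel_imp_Bolzano_Weierstrass[of "{0..T}" ?Z] by (auto simp only: compact_Icc)
  have "closed ?Z"
    by (rule continuous_closed_preimage_constant) (auto intro: u_cont_sub)
  then have "x \<in> ?Z"
    using x(2) unfolding closed_limpt by blast
  then have ux: "u x = 0" by simp
  \<comment> \<open>Relative to the zero set \<open>u\<close> is constant, so its derivative there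
    is 0 as well as \<open>v x\<close>; uniqueness holds because \<open>x\<close> is a limit point
    of that set.\<close>
  have "(u has_vector_derivative v x) (at x within ?Z)"
    using DERIV_subset[OF u_deriv_within[of x], of ?Z] x(1)
    by (auto simp: has_real_derivative_iff_has_vector_derivative)
  moreover have "(u has_vector_derivative 0) (at x within ?Z)"
    by (rule has_vector_derivative_transform[where f = "\<lambda>_. 0"]) (use ux x(1) in simp_all)
  moreover have "at x within ?Z \<noteq> bot"
    using x(2) by (simp only: trivial_limit_within not_not)
  ultimately have "v x = 0"
    by (rule vector_derivative_unique_within[rotated])
  then have "E x = 0"
    using ux by (simp add: E_def)
  then show False using assms[of x] x by simp
qed

section \<open>Signs of the velocity while the position is positive\<close>

lemma rhs_le_if_v_nonneg:
  assumes "v t \<ge> 0" "u t \<ge> m" "m > 0"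
  shows "rhs t \<le> - (d * m powr (\<beta> + 1))"
proof -
  have "m powr (\<beta> + 1) \<le> u t powr (\<beta> + 1)"
    using assms beta_pos by (intro powr_mono2) auto
  moreover have "u t powr (\<beta> + 1) = \<bar>u t\<bar> powr \<beta> * u t"
    using assms by (simp add: powr_add)
  ultimately have "d * m powr (\<beta> + 1) \<le> d * (\<bar>u t\<bar> powr \<beta> * u t)"
    using d_pos by simp
  moreover have "c * (\<bar>v t\<bar> powr \<alpha> * v t) \<ge> 0"
    using c_pos assms by simp
  ultimately show ?thesis by (simp add: rhs_def)
qed

text \<open>As long as \<open>v > 0\<close>, \<open>u\<close> stays above \<open>u T\<close>, so the
  restoring force makes \<open>w\<close> fall at least at the constant rate \<open>m\<close>; it
  would be used up by time \<open>T + w T / m\<close>.\<close>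

lemma positive_velocity_stops:
  assumes "T > 0" "u T > 0"
  shows "\<exists>t\<ge>T. v t \<le> 0"
proof (rule ccontr)
  assume "\<not> ?thesis"
  then have vpos: "v t > 0" if "t \<ge> T" for t using that by force
  have u_ge: "u t \<ge> u T" if "t \<ge> T" for t
  proof (rule DERIV_nonneg_imp_nondecreasing[OF that])
    fix x assume "T \<le> x" "x \<le> t"
    then show "\<exists>y. (u has_real_derivative y) (at x) \<and> 0 \<le> y"
      using u_deriv[of x] vpos[of x] assms by (auto intro!: exI[of _ "v x"])
  qed
  define m where "m = d * u T powr (\<beta> + 1)"
  have m: "m > 0" using d_pos assms by (simp add: m_def)
  define t where "t = T + w T / m"
  have wT: "w T > 0" using vpos[of T] by (simp add: w_def)
  then have t: "t \<ge> T" using m by (simp add: t_def)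
  have "w t + m * t \<le> w T + m * T"
  proof (rule DERIV_nonpos_imp_nonincreasing[OF t])
    fix x assume x: "T \<le> x" "x \<le> t"
    have "((\<lambda>t. w t + m * t) has_real_derivative rhs x + m) (at x)"
      using x assms by (auto intro!: derivative_eq_intros w_deriv)
    moreover have "rhs x + m \<le> 0"
      using rhs_le_if_v_nonneg[of x "u T"] vpos[of x] u_ge[of x] assms x by (simp add: m_def)
    ultimately show "\<exists>y. ((\<lambda>t. w t + m * t) has_real_derivative y) (at x) \<and> y \<le> 0" by blast
  qed
  then have "w t \<le> 0" using m by (simp add: t_def algebra_simps)
  then show False using vpos[OF t] by (simp add: w_def mult_le_0_iff)
qed

text \<open>Where \<open>v = 0\<close> and \<open>u > 0\<close>, \<open>w\<close> has the negative
  slope \<open>- d * u powr (\<beta> + 1)\<close>, so the sign can only change downwards. The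
  argument runs on \<open>w\<close>, as \<open>v\<close> need not be differentiable at such
  points.\<close>

lemma velocity_negative:
  assumes "0 < a" "a < b" "v a \<le> 0" and upos: "\<And>t. a \<le> t \<Longrightarrow> t \<le> b \<Longrightarrow> u t > 0"
  shows "v b < 0"
proof -
  have "- w b > 0"
  proof (rule stays_positive[OF _ assms(2)])
    show "continuous_on {a..b} (\<lambda>t. - w t)"
      using assms by (intro continuous_intros w_cont_sub) auto
    show "- w a \<ge> 0" using assms by (simp add: w_def mult_le_0_iff)
    fix t assume t: "a \<le> t" "t \<le> b" "- w t = 0"
    then have "v t = 0" by (simp add: w_def)
    then have "- rhs t > 0" using upos[of t] t d_pos by (simp add: rhs_def)
    moreover have "((\<lambda>t. - w t) has_real_derivative - rhs t) (at t)"
      using t assms by (intro DERIV_minus w_deriv) auto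
    ultimately show "\<exists>D>0. ((\<lambda>t. - w t) has_real_derivative D) (at t)" by blast
  qed
  then show ?thesis
    by (simp add: w_def mult_less_0_iff)
qed

text \<open>Inverting the signed power shows that the second derivative of \<open>u\<close> has the
  sign of \<open>rhs\<close> wherever \<open>v\<close> is nonzero.\<close>

lemma v_deriv:
  assumes "t > 0" "v t \<noteq> 0"
  shows "(v has_real_derivative rhs t / ((l + 1) * \<bar>v t\<bar> powr l)) (at t)"
proof -
  have "w t \<noteq> 0" using assms by (simp add: w_def)
  have v: "v s = sgn (w s) * \<bar>w s\<bar> powr (1 / (l + 1))" for s
    by (simp only: w_facts(2,3) mult_sgn_abs)
  have "((\<lambda>s. sgn (w s) * \<bar>w s\<bar> powr (1 / (l + 1))) has_real_derivative
      1 / (l + 1) * \<bar>w t\<bar> powr (1 / (l + 1) - 1) * rhs t) (at t)"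
    using DERIV_chain2[OF has_real_derivative_signed_root[OF \<open>w t \<noteq> 0\<close>] w_deriv[OF assms(1)]] .
  then have "(v has_real_derivative 1 / (l + 1) * \<bar>w t\<bar> powr (1 / (l + 1) - 1) * rhs t) (at t)"
    by (simp flip: v)
  moreover have "\<bar>w t\<bar> powr (1 / (l + 1) - 1) = \<bar>v t\<bar> powr (- l)"
    unfolding w_facts(1) powr_powr
    by (rule arg_cong2[where f = "(powr)"]) (use l_nonneg in \<open>auto simp: field_simps\<close>)
  ultimately have "(v has_real_derivative 1 / (l + 1) * \<bar>v t\<bar> powr (- l) * rhs t) (at t)"
    by (simp only:)
  then show ?thesis
    by (simp add: powr_minus_divide)
qed

section \<open>Energy loss at late zeros\<close>

lemma rhs_bounded: "\<exists>L>0. \<forall>t\<ge>0. \<bar>rhs t\<bar> \<le> L"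
proof -
  define V where "V = ((l + 2) / (l + 1) * E 0) powr (1 / (l + 2))"
  define U where "U = ((\<beta> + 2) / d * E 0) powr (1 / (\<beta> + 2))"
  define L where "L = c * (V powr \<alpha> * V) + d * (U powr \<beta> * U)"
  have "\<bar>rhs t\<bar> \<le> L" if "t \<ge> 0" for t
  proof -
    have V: "\<bar>v t\<bar> \<le> V" and U: "\<bar>u t\<bar> \<le> U"
      using v_bound[of 0 t] u_bound[of 0 t] that by (auto simp: V_def U_def)
    have "\<bar>rhs t\<bar> \<le> \<bar>c * (\<bar>v t\<bar> powr \<alpha> * v t)\<bar> + \<bar>d * (\<bar>u t\<bar> powr \<beta> * u t)\<bar>"
      unfolding rhs_def by linarith
    also have "\<dots> = c * (\<bar>v t\<bar> powr \<alpha> * \<bar>v t\<bar>) + d * (\<bar>u t\<bar> powr \<beta> * \<bar>u t\<bar>)"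
      using c_pos d_pos by (simp add: abs_mult)
    also have "\<dots> \<le> L"
      unfolding L_def using V U c_pos d_pos alpha_pos beta_pos
      by (intro add_mono mult_left_mono mult_mono powr_mono2) auto
    finally show ?thesis .
  qed
  then show ?thesis by (intro exI[of _ "max L 1"]) force
qed

text \<open>At a zero of \<open>u\<close> all energy is kinetic, so the speed is bounded below
  there; as \<open>w\<close> is Lipschitz, a comparable speed persists for a fixed time and costs a
  fixed amount of energy.\<close>

lemma dissipation_at_zeros:
  assumes e: "e > 0" "\<And>t. t \<ge> 0 \<Longrightarrow> E t \<ge> e"
  obtains h \<kappa> where "h > 0" "\<kappa> > 0" "\<And>t. t > 0 \<Longrightarrow> u t = 0 \<Longrightarrow> E (t + h) \<le> E t - \<kappa>"
proof -
  obtain L where L: "L > 0" "\<And>t. t \<ge> 0 \<Longrightarrow> \<bar>rhs t\<bar> \<le> L"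
    using rhs_bounded by blast
  \<comment> \<open>At a zero, \<open>\<bar>v\<bar>\<close> is at least \<open>v0\<close> and
    \<open>\<bar>w\<bar>\<close> at least \<open>w0\<close>. The speed \<open>v1\<close> corresponds
    to \<open>\<bar>w\<bar> = w0 / 2\<close>, and \<open>h\<close> is the time needed to lose
    \<open>w0 / 2\<close> at slope \<open>L\<close>.\<close>
  define v0 where "v0 = ((l + 2) / (l + 1) * e) powr (1 / (l + 2))"
  define w0 where "w0 = v0 powr (l + 1)"
  define v1 where "v1 = (w0 / 2) powr (1 / (l + 1))"
  define h where "h = w0 / (2 * L)"
  define \<kappa> where "\<kappa> = c * v1 powr (\<alpha> + 2) * h"
  have "v0 > 0" using e l_nonneg by (simp add: v0_def)
  then have "w0 > 0" by (simp add: w0_def)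
  then have "v1 > 0" "h > 0" using L by (simp_all add: v1_def h_def)
  then have "\<kappa> > 0" using c_pos by (simp add: \<kappa>_def)
  show thesis
  proof (rule that[OF \<open>h > 0\<close> \<open>\<kappa> > 0\<close>])
    fix t assume t: "t > 0" "u t = 0"
    have "(l + 2) / (l + 1) * e \<le> \<bar>v t\<bar> powr (l + 2)"
      using e(2)[of t] t beta_pos l_nonneg by (simp add: E_def field_simps)
    then have "v0 \<le> (\<bar>v t\<bar> powr (l + 2)) powr (1 / (l + 2))"
      unfolding v0_def using l_nonneg e by (intro powr_mono2) auto
    then have "v0 \<le> \<bar>v t\<bar>"
      using l_nonneg by (simp add: powr_powr)
    then have wt: "w0 \<le> \<bar>w t\<bar>"
      unfolding w0_def w_facts(1) using l_nonneg \<open>v0 > 0\<close> by (intro powr_mono2) auto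
    have vs: "v1 \<le> \<bar>v s\<bar>" if s: "t \<le> s" "s \<le> t + h" for s
    proof -
      have "\<bar>w s - w t\<bar> \<le> L * \<bar>s - t\<bar>"
        using field_differentiable_bound[of "{t..s}" w rhs L s t] s t L w_deriv
        by (auto simp: has_field_derivative_at_within)
      also have "\<dots> \<le> L * h" using s L by simp
      also have "\<dots> = w0 / 2" using L by (simp add: h_def)
      finally have "w0 / 2 \<le> \<bar>w s\<bar>" using wt by linarith
      then have "v1 \<le> \<bar>w s\<bar> powr (1 / (l + 1))"
        unfolding v1_def using l_nonneg \<open>w0 > 0\<close> by (intro powr_mono2) auto
      then show ?thesis by (simp only: w_facts(3))
    qed
    have "E (t + h) + c * v1 powr (\<alpha> + 2) * (t + h) \<le> E t + c * v1 powr (\<alpha> + 2) * t"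
    proof (rule DERIV_nonpos_imp_nonincreasing[where a = t and b = "t + h"])
      fix s assume s: "t \<le> s" "s \<le> t + h"
      have "((\<lambda>s. E s + c * v1 powr (\<alpha> + 2) * s) has_real_derivative
          - c * \<bar>v s\<bar> powr (\<alpha> + 2) + c * v1 powr (\<alpha> + 2)) (at s)"
        using s t by (auto intro!: derivative_eq_intros E_deriv)
      moreover have "v1 powr (\<alpha> + 2) \<le> \<bar>v s\<bar> powr (\<alpha> + 2)"
        using vs[OF s] \<open>v1 > 0\<close> alpha_pos by (intro powr_mono2) auto
      then have "- c * \<bar>v s\<bar> powr (\<alpha> + 2) + c * v1 powr (\<alpha> + 2) \<le> 0"
        using c_pos by simp
      ultimately show "\<exists>y. ((\<lambda>s. E s + c * v1 powr (\<alpha> + 2) * s) has_real_derivative y) (at s) \<and> y \<le> 0"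
        by blast
    qed (use \<open>h > 0\<close> in simp)
    then show "E (t + h) \<le> E t - \<kappa>"
      by (simp add: \<kappa>_def algebra_simps)
  qed
qed

text \<open>Otherwise the energy would stay above \<open>e\<close>, and infinitely many zeros, each
  costing at least \<kappa>, would make it negative.\<close>

lemma energy_small_at_zero:
  assumes unbounded: "\<And>T. \<exists>t>T. u t = 0" and "e > 0"
  shows "\<exists>t>0. u t = 0 \<and> E t < e"
proof (rule ccontr)
  assume no: "\<not> ?thesis"
  have "E t \<ge> e" if t: "t \<ge> 0" for t
  proof -
    obtain t' where "t' > t" "u t' = 0" using unbounded by blast
    then have "E t' \<ge> e" using no t by force
    then show ?thesis using E_antimono[of t t'] \<open>t' > t\<close> t by simp
  qed
  then obtain h \<kappa> where h: "h > 0" "\<kappa> > 0"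
    and drop: "\<And>t. t > 0 \<Longrightarrow> u t = 0 \<Longrightarrow> E (t + h) \<le> E t - \<kappa>"
    using dissipation_at_zeros[OF \<open>e > 0\<close>] by blast
  have "\<exists>t\<ge>0. E t \<le> E 0 - real n * \<kappa>" for n
  proof (induction n)
    case 0
    then show ?case by auto
  next
    case (Suc n)
    then obtain t where t: "t \<ge> 0" "E t \<le> E 0 - real n * \<kappa>" by blast
    obtain t' where t': "t' > t" "u t' = 0" using unbounded by blast
    then have "E (t' + h) \<le> E t - \<kappa>"
      using drop[of t'] E_antimono[of t t'] t by simp
    then have "E (t' + h) \<le> E 0 - real (Suc n) * \<kappa>"
      using t by (simp add: algebra_simps)
    then show ?case using t t' h by (intro exI[of _ "t' + h"]) auto
  qed
  moreover obtain n where "real n * \<kappa> > E 0"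
    using ex_less_of_nat_mult[OF h(2)] by blast
  ultimately show False
    using E_nonneg by (smt (verit))
qed

section \<open>Turning points, and the barrier that excludes later zeros\<close>

lemma turning_point_pos:
  assumes "t0 > 0" "u t0 = 0" "v t0 > 0"
  shows "\<exists>t>t0. v t = 0"
proof -
  have "\<exists>t>t0. v t \<le> 0"
  \<comment> \<open>\<open>positive_velocity_stops\<close> needs a positive position, but
    \<open>u t0 = 0\<close>; hence the waiting time of one unit.\<close>
  proof (cases "\<forall>t\<in>{t0..t0 + 1}. v t > 0")
    case True
    have "u t0 < u (t0 + 1)"
    proof (rule DERIV_pos_imp_increasing[where a = t0 and b = "t0 + 1"])
      fix x assume "t0 \<le> x" "x \<le> t0 + 1"
      then show "\<exists>y. (u has_real_derivative y) (at x) \<and> 0 < y"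
        using u_deriv[of x] True assms by (intro exI[of _ "v x"]) auto
    qed simp
    then show ?thesis
      using positive_velocity_stops[of "t0 + 1"] assms by force
  next
    case False
    then show ?thesis using assms(3) by (metis atLeastAtMost_iff less_eq_real_def not_le)
  qed
  then obtain t where t: "t > t0" "v t \<le> 0" by blast
  then obtain s where "t0 < s" "v s = 0"
    using first_zero[of t0 t v] assms v_cont_sub[of t0 t] by (metis less_eq_real_def)
  then show ?thesis by blast
qed

lemma turning_point:
  assumes "t0 > 0" "u t0 = 0" "E t0 > 0"
  shows "\<exists>t>t0. v t = 0"
proof -
  interpret N: damped_ode l \<alpha> \<beta> c d "\<lambda>t. - u t" "\<lambda>t. - v t"
    by (rule negated)
  have "v t0 \<noteq> 0" using assms by (auto simp: E_def)
  then show ?thesis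
    using turning_point_pos[of t0] N.turning_point_pos[of t0] assms
    by (cases "v t0 > 0") auto
qed

text \<open>Barrier: as long as \<open>u\<close> is small, \<open>- v\<close> stays below the curve \<open>M * u powr p\<close>.
  With \<open>c * M powr (\<alpha> + 1) = 2 * d\<close> and \<open>p = (\<beta> + 1) / (\<alpha> + 1)\<close> the damping is twice the restoring
  force on that curve, and \<open>\<delta> > 0\<close> makes the inertial term negligible.\<close>

lemma no_return:
  fixes p M \<delta> :: real
  defines "p \<equiv> (\<beta> + 1) / (\<alpha> + 1)" and "M \<equiv> (2 * d / c) powr (1 / (\<alpha> + 1))"
  defines "\<delta> \<equiv> p * (l + 2) - (\<beta> + 2)"
  assumes "p \<ge> 1" "\<delta> > 0"
    and t1: "t1 > 0" "v t1 = 0" "u t1 > 0"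
    and small: "p * (l + 1) * M powr (l + 2) * u t1 powr \<delta> < d"
    and "t \<ge> t1"
  shows "u t > 0"
proof (rule ccontr)
  assume "\<not> u t > 0"
  then obtain b where b: "t1 < b" "u b = 0" "\<And>s. t1 \<le> s \<Longrightarrow> s < b \<Longrightarrow> u s > 0"
    using first_zero[of t1 t u] u_cont_sub[of t1 t] t1 \<open>t \<ge> t1\<close> by (metis less_eq_real_def not_le)
  have M: "M > 0" "c * M powr (\<alpha> + 1) = 2 * d"
    using c_pos d_pos alpha_pos by (auto simp: M_def powr_powr)
  define q where "q = p * (l + 1)"
  have vneg: "v s < 0" if "t1 < s" "s < b" for s
    using velocity_negative[of t1 s] t1 b(3) that by auto
  have u_le: "u s \<le> u t1" if s: "t1 \<le> s" "s < b" for s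
  proof (rule DERIV_nonpos_imp_nonincreasing[OF s(1)])
    fix x assume x: "t1 \<le> x" "x \<le> s"
    have "v x \<le> 0" using vneg[of x] x s t1 by (cases "x = t1") auto
    then show "\<exists>y. (u has_real_derivative y) (at x) \<and> y \<le> 0"
      using u_deriv[of x] x t1 by (intro exI[of _ "v x"]) auto
  qed
  \<comment> \<open>For \<open>w < 0\<close>, \<open>g > 0\<close> says that \<open>- v\<close> is
    below the barrier. Raising both sides to the power \<open>l + 1\<close> replaces
    \<open>- v\<close> by \<open>- w\<close>, whose derivative the equation gives directly.\<close>
  define g where "g s = M powr (l + 1) * u s powr q + w s" for s
  have curve: "M powr (l + 1) * u s powr q = (M * u s powr p) powr (l + 1)" if "u s > 0" for s
    using M that by (simp add: powr_mult powr_powr q_def)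
  have gpos: "g s > 0" if s: "t1 < s" "s < b" for s
  proof (rule stays_positive[OF _ s(1)])
    show "continuous_on {t1..s} g"
      unfolding g_def[abs_def]
    proof (intro continuous_intros u_cont_sub w_cont_sub)
      show "\<forall>x\<in>{t1..s}. u x \<noteq> 0" using b(3) s by force
    qed (use t1 in auto)
    show "g t1 \<ge> 0" using M t1 by (simp add: g_def w_def)
    fix x assume x: "t1 \<le> x" "x \<le> s" and gx: "g x = 0"
    define y where "y = M * u x powr p"
    have ux: "u x > 0" using b(3) x s by auto
    have "x \<noteq> t1" using gx t1 M by (auto simp: g_def w_def)
    then have "v x < 0" using vneg x s by auto
    then have "w x < 0" by (simp add: w_def mult_less_0_iff)
    then have "\<bar>v x\<bar> powr (l + 1) = y powr (l + 1)"
      using gx curve[OF ux] w_facts(1)[of x] by (simp add: g_def y_def)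
    then have "(\<bar>v x\<bar> powr (l + 1)) powr (1 / (l + 1)) = (y powr (l + 1)) powr (1 / (l + 1))"
      by (simp only:)
    moreover have "y > 0" using ux M by (simp add: y_def)
    ultimately have "\<bar>v x\<bar> = y"
      using l_nonneg by (simp add: powr_powr)
    then have vx: "v x = - y" using \<open>v x < 0\<close> by simp
    have "c * y powr (\<alpha> + 1) = c * M powr (\<alpha> + 1) * u x powr (\<beta> + 1)"
      using M ux alpha_pos by (simp add: y_def powr_mult powr_powr p_def)
    then have damp: "c * y powr (\<alpha> + 1) = 2 * d * u x powr (\<beta> + 1)"
      by (simp only: M(2))
    \<comment> \<open>On the curve the net force is twice the restoring force minus the restoring
      force, hence positive.\<close>
    have rhs: "rhs x = d * u x powr (\<beta> + 1)"
      using damp \<open>y > 0\<close> ux by (simp add: rhs_def vx powr_add)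
    have "(g has_real_derivative M powr (l + 1) * (q * u x powr (q - 1) * v x) + rhs x) (at x)"
      unfolding g_def[abs_def] using x t1 ux
      by (auto intro!: derivative_eq_intros u_deriv w_deriv)
    \<comment> \<open>The motion of the barrier itself contributes the power
      \<open>q - 1 + p = \<beta> + 1 + \<delta>\<close> of \<open>u\<close>, of higher order than
      the net force; \<open>small\<close> makes the latter win.\<close>
    moreover have "M powr (l + 1) * (q * u x powr (q - 1) * v x) + rhs x
        = u x powr (\<beta> + 1) * (d - q * M powr (l + 2) * u x powr \<delta>)"
    proof -
      have "u x powr (q - 1) * u x powr p = u x powr (\<beta> + 1) * u x powr \<delta>"
        unfolding powr_add[symmetric] by (rule arg_cong[where f = "\<lambda>r. _ powr r"])
          (simp add: \<delta>_def q_def algebra_simps)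
      moreover have "M powr (l + 1) * M = M powr (l + 2)"
        using M powr_add[of M "l + 1" 1] by (simp add: add.commute)
      moreover have "M powr (l + 1) * (q * u x powr (q - 1) * v x)
          = - q * (M powr (l + 1) * M) * (u x powr (q - 1) * u x powr p)"
        by (simp add: vx y_def)
      ultimately show ?thesis by (simp add: rhs algebra_simps)
    qed
    moreover have "q * M powr (l + 2) * u x powr \<delta> < d"
    proof -
      have "u x powr \<delta> \<le> u t1 powr \<delta>"
        using u_le[of x] x s ux \<open>\<delta> > 0\<close> by (intro powr_mono2) auto
      then have "q * M powr (l + 2) * u x powr \<delta> \<le> q * M powr (l + 2) * u t1 powr \<delta>"
        using l_nonneg \<open>p \<ge> 1\<close> by (intro mult_left_mono) (auto simp: q_def)
      then show ?thesis using small by (simp add: q_def)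
    qed
    ultimately show "\<exists>D>0. (g has_real_derivative D) (at x)"
      using ux by (metis diff_gt_0_iff_gt mult_pos_pos powr_gt_zero less_irrefl)
  qed
  \<comment> \<open>As \<open>p \<ge> 1\<close> and \<open>u \<le> u t1\<close>, the barrier lies
    below the line \<open>K * u\<close>. Then \<open>u * exp (K * t)\<close> is nondecreasing and
    cannot reach 0 at \<open>b\<close>.\<close>
  define K where "K = M * u t1 powr (p - 1)"
  have v_ge: "v s \<ge> - K * u s" if s: "t1 < s" "s < b" for s
  proof -
    have us: "u s > 0" using b(3) s by auto
    have "w s < 0" using vneg[OF s] by (simp add: w_def mult_less_0_iff)
    then have "\<bar>w s\<bar> \<le> (M * u s powr p) powr (l + 1)"
      using gpos[OF s] by (simp add: g_def curve[OF us])
    then have "\<bar>w s\<bar> powr (1 / (l + 1)) \<le> ((M * u s powr p) powr (l + 1)) powr (1 / (l + 1))"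
      using l_nonneg by (intro powr_mono2) auto
    then have "\<bar>v s\<bar> \<le> M * u s powr p"
      using l_nonneg M us by (simp add: w_facts(3) powr_powr del: w_facts(1))
    also have "u s powr p = u s powr (p - 1) * u s"
      using us powr_add[of "u s" "p - 1" 1] by simp
    also have "M * (u s powr (p - 1) * u s) \<le> M * (u t1 powr (p - 1) * u s)"
      using M us u_le[of s] s \<open>p \<ge> 1\<close> by (intro mult_left_mono mult_right_mono powr_mono2) auto
    finally show ?thesis by (simp add: K_def)
  qed
  have "u t1 * exp (K * t1) \<le> u b * exp (K * b)"
  proof (rule DERIV_nonneg_imp_increasing_open[where a = t1 and b = b])
    fix x assume x: "t1 < x" "x < b"
    have "((\<lambda>x. u x * exp (K * x)) has_real_derivative (v x + K * u x) * exp (K * x)) (at x)"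
      using x t1 by (auto intro!: derivative_eq_intros u_deriv simp: algebra_simps)
    then show "\<exists>y. ((\<lambda>x. u x * exp (K * x)) has_real_derivative y) (at x) \<and> 0 \<le> y"
      using v_ge[OF x] by (intro exI conjI) auto
  qed (use b t1 in \<open>auto intro!: continuous_intros u_cont_sub\<close>)
  then show False
    using b t1 by (simp add: mult_le_0_iff)
qed

text \<open>After a late zero of low energy comes a turning point with \<open>\<bar>u\<bar>\<close>
  small enough for \<open>no_return\<close>, applied to \<open>u\<close> or \<open>- u\<close>; this
  contradicts the existence of a still later zero.\<close>

lemma eventually_nonzero:
  assumes "l \<le> \<beta>" "\<alpha> < (\<beta> * (l + 1) + l) / (\<beta> + 2)"
    and Epos: "\<And>t. t \<ge> 0 \<Longrightarrow> E t > 0"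
  shows "\<exists>T. \<forall>t>T. u t \<noteq> 0"
proof (rule ccontr)
  assume "\<not> ?thesis"
  then have unbounded: "\<And>T. \<exists>t>T. u t = 0" by blast
  define p where "p = (\<beta> + 1) / (\<alpha> + 1)"
  define M where "M = (2 * d / c) powr (1 / (\<alpha> + 1))"
  define \<delta> where "\<delta> = p * (l + 2) - (\<beta> + 2)"
  have \<alpha>: "\<alpha> * (\<beta> + 2) < \<beta> * (l + 1) + l"
    using assms(2) beta_pos by (simp add: pos_less_divide_eq)
  \<comment> \<open>This is \<open>l * (\<beta> + 1) \<le> \<beta> * (\<beta> + 1)\<close>
    rearranged; it yields \<alpha> < \<beta> and so \<open>p \<ge> 1\<close>.\<close>
  also have "\<dots> \<le> \<beta> * (\<beta> + 2)"
    using mult_right_mono[OF assms(1), of "\<beta> + 1"] beta_pos by (simp add: algebra_simps)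
  finally have "\<alpha> < \<beta>" using beta_pos by simp
  then have p: "p \<ge> 1" using alpha_pos by (simp add: p_def)
  \<comment> \<open>The bound on \<alpha>, expanded, is precisely the condition \<delta> >
    0.\<close>
  have "(\<beta> + 2) * (\<alpha> + 1) < (\<beta> + 1) * (l + 2)"
    using \<alpha> by (simp add: algebra_simps)
  then have \<delta>: "\<delta> > 0" using alpha_pos by (simp add: \<delta>_def p_def field_simps)
  define A where "A = p * (l + 1) * M powr (l + 2)"
  have A: "A > 0"
    using p l_nonneg c_pos d_pos by (auto simp: A_def M_def intro!: mult_pos_pos)
  \<comment> \<open>Chosen so that \<open>A * x0 powr \<delta> = d / 2\<close>, half of what
    \<open>no_return\<close> tolerates.\<close>
  define x0 where "x0 = (d / (2 * A)) powr (1 / \<delta>)"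
  have x0: "x0 > 0" using A d_pos by (simp add: x0_def)
  have A_small: "A * x powr \<delta> < d" if "0 \<le> x" "x \<le> x0" for x
  proof -
    have "x powr \<delta> \<le> x0 powr \<delta>" using that \<delta> by (intro powr_mono2) auto
    also have "\<dots> = d / (2 * A)" using \<delta> A d_pos by (simp add: x0_def powr_powr)
    finally have "A * x powr \<delta> \<le> d / 2" using A by (simp add: field_simps)
    then show ?thesis using d_pos by simp
  qed
  \<comment> \<open>The threshold is the potential energy at \<open>\<bar>u\<bar> = x0\<close>, so
    \<open>\<bar>u\<bar>\<close> is at most \<open>x0\<close> from \<open>t0\<close> on.\<close>
  obtain t0 where t0: "t0 > 0" "u t0 = 0" "E t0 < d / (\<beta> + 2) * x0 powr (\<beta> + 2)"
    using energy_small_at_zero[OF unbounded, of "d / (\<beta> + 2) * x0 powr (\<beta> + 2)"] x0 d_pos beta_pos by auto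
  have "(\<beta> + 2) / d * E t0 \<le> x0 powr (\<beta> + 2)"
    using t0(3) beta_pos d_pos by (simp add: field_simps)
  then have "((\<beta> + 2) / d * E t0) powr (1 / (\<beta> + 2)) \<le> (x0 powr (\<beta> + 2)) powr (1 / (\<beta> + 2))"
    using beta_pos d_pos E_nonneg[of t0] by (intro powr_mono2) auto
  then have "((\<beta> + 2) / d * E t0) powr (1 / (\<beta> + 2)) \<le> x0"
    using beta_pos x0 by (simp add: powr_powr)
  moreover obtain t1 where t1: "t1 > t0" "v t1 = 0"
    using turning_point[of t0] Epos[of t0] t0 by auto
  ultimately have u_small: "\<bar>u t1\<bar> \<le> x0"
    using u_bound[of t0 t1] t0 by simp
  have u_t1: "u t1 \<noteq> 0"
    using Epos[of t1] t0 t1 by (auto simp: E_def)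
  obtain t2 where t2: "t2 > t1" "u t2 = 0"
    using unbounded by blast
  interpret N: damped_ode l \<alpha> \<beta> c d "\<lambda>t. - u t" "\<lambda>t. - v t"
    by (rule negated)
  show False
  proof (cases "u t1 > 0")
    case True
    show False
      using no_return[of t1 t2, folded p_def M_def, folded \<delta>_def A_def]
        p \<delta> t0 t1 t2 True A_small[of "u t1"] u_small by simp
  next
    case False
    show False
      using N.no_return[of t1 t2, folded p_def M_def, folded \<delta>_def A_def]
        p \<delta> t0 t1 t2 False u_t1 A_small[of "- u t1"] u_small by simp
  qed
qed

section \<open>Eventual signs of the first and second derivatives\<close>

lemma eventually_convex_decay:
  assumes "T > 0" and upos: "\<And>t. t \<ge> T \<Longrightarrow> u t > 0"
  shows "\<exists>S. \<forall>t>S. v t < 0 \<and> (\<exists>D>0. (v has_real_derivative D) (at t))"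
proof -
  obtain T1 where T1: "T1 \<ge> T" "v T1 \<le> 0"
    using positive_velocity_stops[of T] assms by auto
  define T2 where "T2 = T1 + 1"
  have T2: "T2 > 0" "T2 \<ge> T" using T1 assms by (auto simp: T2_def)
  have vneg: "v t < 0" if "t \<ge> T2" for t
    using velocity_negative[of T1 t] T1 assms that by (auto simp: T2_def)
  have "\<exists>T3\<ge>T2. rhs T3 \<ge> 0"
  proof (rule ccontr)
    assume "\<not> ?thesis"
    then have rneg: "rhs t < 0" if "t \<ge> T2" for t using that by force
    have v_le: "v t \<le> v T2" if t: "t \<ge> T2" for t
    proof (rule DERIV_nonpos_imp_nonincreasing[OF t])
      fix x assume x: "T2 \<le> x" "x \<le> t"
      have "rhs x / ((l + 1) * \<bar>v x\<bar> powr l) \<le> 0"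
        using rneg[of x] x l_nonneg by (intro divide_nonpos_nonneg) auto
      then show "\<exists>y. (v has_real_derivative y) (at x) \<and> y \<le> 0"
        using v_deriv[of x] vneg[of x] x T2 by fastforce
    qed
    \<comment> \<open>The time at which motion at the constant speed \<open>- v T2\<close> reaches
      0; with \<open>v\<close> decreasing, \<open>u\<close> is no later.\<close>
    define t where "t = T2 + u T2 / (- v T2)"
    have vT2: "v T2 < 0" using vneg by simp
    then have t: "t \<ge> T2" using upos[of T2] T2 by (simp add: t_def divide_nonneg_neg divide_le_0_iff)
    have "u t - v T2 * t \<le> u T2 - v T2 * T2"
    proof (rule DERIV_nonpos_imp_nonincreasing[OF t])
      fix x assume x: "T2 \<le> x" "x \<le> t"
      have "((\<lambda>t. u t - v T2 * t) has_real_derivative v x - v T2) (at x)"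
        using x T2 by (auto intro!: derivative_eq_intros u_deriv)
      then show "\<exists>y. ((\<lambda>t. u t - v T2 * t) has_real_derivative y) (at x) \<and> y \<le> 0"
        using v_le[of x] x by (intro exI conjI) auto
    qed
    moreover have "v T2 * t = v T2 * T2 - u T2" using vT2 by (simp add: t_def field_simps)
    ultimately have "u t \<le> 0" by linarith
    then show False using upos[of t] t T2 by simp
  qed
  then obtain T3 where T3: "T3 \<ge> T2" "rhs T3 \<ge> 0" by blast
  \<comment> \<open>\<open>Z\<close> is \<open>rhs\<close> written with powers of positive
    bases.\<close>
  define Z where "Z t = c * (- v t) powr (\<alpha> + 1) - d * u t powr (\<beta> + 1)" for t
  have rhs_Z: "rhs t = Z t" if "t \<ge> T2" for t
    using vneg[OF that] upos[of t] T2 that by (simp add: rhs_def Z_def powr_add)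
  have "rhs t > 0" if t: "t > T3" for t
  proof -
    have "Z t > 0"
    proof (rule stays_positive[OF _ t])
      show "continuous_on {T3..t} Z"
        unfolding Z_def[abs_def]
      proof (intro continuous_intros u_cont_sub v_cont_sub)
        show "\<forall>x\<in>{T3..t}. - v x \<noteq> 0" "\<forall>x\<in>{T3..t}. u x \<noteq> 0"
          using vneg upos T2 T3 by (auto simp: less_le)
      qed (use T2 T3 in auto)
      show "Z T3 \<ge> 0" using T3 rhs_Z[of T3] by simp
      fix x assume x: "T3 \<le> x" "x \<le> t" and Zx: "Z x = 0"
      have vx: "v x < 0" and ux: "u x > 0" using vneg[of x] upos[of x] x T2 T3 by auto
      \<comment> \<open>At a zero of \<open>Z\<close> the damping term is stationary, so only the
        decrease of \<open>u\<close> counts, and it makes \<open>Z\<close> increase.\<close>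
      have "(v has_real_derivative 0) (at x)"
        using v_deriv[of x] vx rhs_Z[of x] Zx x T2 T3 by simp
      then have "(Z has_real_derivative - (d * ((\<beta> + 1) * u x powr \<beta> * v x))) (at x)"
        unfolding Z_def[abs_def] using vx ux x T2 T3
        by (auto intro!: derivative_eq_intros u_deriv)
      moreover have "- (d * ((\<beta> + 1) * u x powr \<beta> * v x)) > 0"
        using vx ux d_pos beta_pos by (simp add: mult_less_0_iff mult_pos_neg)
      ultimately show "\<exists>D>0. (Z has_real_derivative D) (at x)" by blast
    qed
    then show ?thesis using rhs_Z[of t] T3 t by simp
  qed
  moreover have "rhs t / ((l + 1) * \<bar>v t\<bar> powr l) > 0" if "rhs t > 0" "t > T3" for t
    using that vneg[of t] T3 l_nonneg by (intro divide_pos_pos mult_pos_pos) auto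
  ultimately have pos: "rhs t / ((l + 1) * \<bar>v t\<bar> powr l) > 0" if "t > T3" for t
    using that by blast
  have "v t < 0 \<and> (\<exists>D>0. (v has_real_derivative D) (at t))" if "t > T3" for t
  proof -
    have "v t < 0" "t > 0" using vneg[of t] T2 T3 that by auto
    moreover from this have "(v has_real_derivative rhs t / ((l + 1) * \<bar>v t\<bar> powr l)) (at t)"
      by (intro v_deriv) auto
    ultimately show ?thesis using pos[OF that] by blast
  qed
  then show ?thesis by blast
qed

end

section \<open>Transfer to solutions on the half-line\<close>

theorem theorem4p2:
  fixes \<alpha> \<beta> c d l :: real and u :: "real \<Rightarrow> real"
  assumes "\<alpha> > 0" and "\<beta> > 0" and "c > 0" and "d > 0" and "l \<ge> 0"
    and "l \<le> \<beta>" and "l < \<alpha>"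
    and "\<alpha> < (\<beta> * (l + 1) + l) / (\<beta> + 2)"
    and "is_solution_rplus l \<alpha> \<beta> c d u"
    and "\<exists>t\<ge>0. u t \<noteq> 0"
  shows "finite {t. t > 0 \<and> u t = 0} \<and>
    (\<forall>\<^sub>F t in at_top.
       sgn (deriv_rplus u t) = - sgn (u t) \<and>
       deriv_rplus u differentiable (at t) \<and>
       sgn (deriv_rplus (deriv_rplus u) t) = sgn (u t))"
proof -
  define v where "v = deriv_rplus u"
  have deriv: "(f has_real_derivative deriv_rplus f t) (at t within {0..})"
    if "C1_rplus f" "t \<ge> 0" for f t
    using that vector_derivative_works[of f "at t within {0..}"]
    by (simp add: C1_rplus_def deriv_rplus_def differentiable_on_def
        has_real_derivative_iff_has_vector_derivative)
  have C1: "C1_rplus u" "C1_rplus (\<lambda>t. \<bar>v t\<bar> powr l * v t)"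
    and eq: "\<And>t. t \<ge> 0 \<Longrightarrow> deriv_rplus (\<lambda>s. \<bar>v s\<bar> powr l * v s) t
        = - (c * (\<bar>v t\<bar> powr \<alpha> * v t) + d * (\<bar>u t\<bar> powr \<beta> * u t))"
    using assms(9) unfolding is_solution_rplus_def v_def by (auto simp: eq_neg_iff_add_eq_0 add.assoc)
  interpret damped_ode l \<alpha> \<beta> c d u v
  proof
    show "(u has_real_derivative v t) (at t within {0..})" if "t \<ge> 0" for t
      using deriv[OF C1(1) that] by (simp add: v_def)
    show "((\<lambda>s. \<bar>v s\<bar> powr l * v s) has_real_derivative
        - (c * (\<bar>v t\<bar> powr \<alpha> * v t) + d * (\<bar>u t\<bar> powr \<beta> * u t))) (at t within {0..})"
      if "t \<ge> 0" for t
      using deriv[OF C1(2) that] eq[OF that] by simp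
    show "continuous_on {0..} v"
      using C1(1) by (simp add: C1_rplus_def v_def)
  qed (use assms in auto)
  interpret N: damped_ode l \<alpha> \<beta> c d "\<lambda>t. - u t" "\<lambda>t. - v t"
    by (rule negated)
  have Epos: "E t > 0" if "t \<ge> 0" for t
    using E_pos assms(10) that by blast
  obtain T0 where T0: "\<And>t. t > T0 \<Longrightarrow> u t \<noteq> 0"
    using eventually_nonzero[OF assms(6,8) Epos] by blast
  have "{t. t > 0 \<and> u t = 0} \<subseteq> {t \<in> {0..T0}. u t = 0}"
    using T0 by force
  then have "finite {t. t > 0 \<and> u t = 0}"
    using finite_zeros_bounded[OF Epos] finite_subset by blast
  \<comment> \<open>Strictly positive, so that derivatives from \<open>T\<close> on are two-sided,
    and beyond \<open>T0\<close>, so that \<open>u T\<close> is already nonzero.\<close>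
  moreover define T where "T = max T0 0 + 1"
  have T: "T > 0" "\<And>t. t \<ge> T \<Longrightarrow> u t \<noteq> 0"
    using T0 by (auto simp: T_def)
  have deriv_v: "v differentiable (at t) \<and> deriv_rplus v t = D"
    if "(v has_real_derivative D) (at t)" "t > 0" for t D
    using that at_within_rplus[OF that(2)]
    by (auto simp: deriv_rplus_def has_real_derivative_iff_has_vector_derivative
        vector_derivative_at intro: differentiableI_vector)
  have same_sign: "u t * u T > 0" if late: "t \<ge> T" for t
  proof (rule ccontr)
    assume "\<not> u t * u T > 0"
    then have neg: "u t * u T \<le> 0" by simp
    have cont: "continuous_on {T..t} (\<lambda>s. u s * u T)"
      by (intro continuous_intros u_cont_sub) (use T in auto)
    have pos: "u T * u T > 0"
      using T(2)[OF order.refl] not_real_square_gt_zero by blast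
    obtain s where "T < s" "u s * u T = 0"
      by (rule first_zero[OF cont late pos neg])
    then show False using T by auto
  qed
  have "\<exists>S. \<forall>t>S. sgn (v t) = - sgn (u t) \<and> v differentiable (at t)
      \<and> sgn (deriv_rplus v t) = sgn (u t)"
  proof (cases "u T > 0")
    case True
    then have upos: "u t > 0" if "t \<ge> T" for t
      using same_sign[OF that] by (simp add: zero_less_mult_iff)
    obtain S where S: "\<forall>t>S. v t < 0 \<and> (\<exists>D>0. (v has_real_derivative D) (at t))"
      using eventually_convex_decay[OF T(1) upos] by blast
    show ?thesis
    proof (intro exI allI impI)
      fix t assume t: "t > max S T"
      then obtain D where "D > 0" "(v has_real_derivative D) (at t)" "v t < 0"
        using S by auto
      then show "sgn (v t) = - sgn (u t) \<and> v differentiable (at t) \<and> sgn (deriv_rplus v t) = sgn (u t)"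
        using deriv_v[of D t] upos[of t] t T by simp
    qed
  next
    case False
    then have uneg: "- u t > 0" if "t \<ge> T" for t
      using same_sign[OF that] T(2)[of T] by (auto simp: zero_less_mult_iff)
    obtain S where S: "\<forall>t>S. - v t < 0 \<and> (\<exists>D>0. ((\<lambda>t. - v t) has_real_derivative D) (at t))"
      using N.eventually_convex_decay[OF T(1) uneg] by blast
    show ?thesis
    proof (intro exI allI impI)
      fix t assume t: "t > max S T"
      then obtain D where "D > 0" "((\<lambda>t. - v t) has_real_derivative D) (at t)" "v t > 0"
        using S by auto
      then have "(v has_real_derivative - D) (at t)"
        using DERIV_minus[of "\<lambda>t. - v t" D] by simp
      then show "sgn (v t) = - sgn (u t) \<and> v differentiable (at t) \<and> sgn (deriv_rplus v t) = sgn (u t)"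
        using deriv_v[of "- D" t] uneg[of t] t T \<open>D > 0\<close> \<open>v t > 0\<close> by simp
    qed
  qed
  ultimately show ?thesis
    unfolding eventually_at_top_dense v_def by blast
qed

end
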